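(* Let $d\ge 1$ and $r\ge 3$, and let $T\in S^r(\mathbb{R}^d)$ be a diagonal tensor such that $T_{i\cdots i}\neq 0$ for at least $d-1$ different values of $i\in\{1,\dots,d\}$. Then for $Q\in \mathrm{O}(d)$, the tensor $Q\bullet T$ is diagonal if and only if $Q\in \mathrm{SP}(d)$; that is, $\{Q\in \mathrm{O}(d): Q\bullet T\in\mathcal{V}^{\rm diag}\}=\mathrm{SP}(d)$. If $r=2$, the same conclusion holds for a diagonal $T\in S^2(\mathbb{R}^d)$ under the stronger condition that $T_{jj}\neq T_{kk}$ for all $j\neq k$.
   Context: $S^r(\mathbb{R}^d)$ is the space of real symmetric $d\times\cdots\times d$ tensors of order $r$ (entries $T_{i_1\cdots i_r}$ invariant under permuting the indices). For $A\in\mathbb{R}^{d\times d}$, $A\bullet T\in S^r(\mathbb{R}^d)$ is defined by $(A\bullet T)_{i_1\cdots i_r}=\sum_{j_1,\dots,j_r=1}^d A_{i_1j_1}\cdots A_{i_rj_r}T_{j_1\cdots j_r}$. A tensor $T$ is diagonal if $T_{i_1\cdots i_r}=0$ unless $i_1=\cdots=i_r$; $\mathcal{V}^{\rm diag}\subset S^r(\mathbb{R}^d)$ is the set of diagonal tensors. $\mathrm{O}(d)$ is the group of real orthogonal $d\times d$ matrices and $\mathrm{SP}(d)$ is the set of $d\times d$ signed permutation matrices, i.e. matrices $DP$ with $D$ diagonal with $\pm1$ diagonal entries and $P$ a permutation matrix. *)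

theory Defs
  imports "HOL-Analysis.Analysis"
begin

text \<open>
  Tensors of format \<open>d \<times> \<dots> \<times> d\<close> and order \<open>r\<close>. The type \<open>'d\<close> indexes the coordinates of
  the underlying real vector space, so \<open>d = CARD('d)\<close>; the type \<open>'r\<close> indexes the \<open>r\<close> slots
  of the tensor, so \<open>r = CARD('r)\<close>. A multi-index \<open>(i\<^sub>1, \<dots>, i\<^sub>r)\<close> is a function \<open>i :: 'r \<Rightarrow> 'd\<close>.
\<close>

type_synonym ('r, 'd) tensor = "(real, 'r \<Rightarrow> 'd) vec"

definition symmetric_tensors :: "('r::finite, 'd::finite) tensor set" where
  "symmetric_tensors = {T. \<forall>\<pi> i. \<pi> permutes UNIV \<longrightarrow> T $ (i \<circ> \<pi>) = T $ i}"

definition tensor_act ::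
    "real^'d^'d \<Rightarrow> ('r::finite, 'd::finite) tensor \<Rightarrow> ('r, 'd) tensor"  (infixr "\<bullet>\<^sub>T" 75) where
  "A \<bullet>\<^sub>T T = (\<chi> i. \<Sum>j\<in>UNIV. (\<Prod>k\<in>UNIV. A $ i k $ j k) * T $ j)"

definition diagonal_tensor :: "('r::finite, 'd::finite) tensor \<Rightarrow> bool" where
  "diagonal_tensor T \<longleftrightarrow> (\<forall>i. \<not> (\<forall>k l. i k = i l) \<longrightarrow> T $ i = 0)"

definition V_diag :: "('r::finite, 'd::finite) tensor set" where
  "V_diag = {T \<in> symmetric_tensors. diagonal_tensor T}"

definition tensor_diag :: "('r::finite, 'd::finite) tensor \<Rightarrow> 'd \<Rightarrow> real" where
  "tensor_diag T a = T $ (\<lambda>_. a)"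

definition orthogonal_group :: "(real^'d^'d) set" where
  "orthogonal_group = {Q. orthogonal_matrix Q}"

definition sign_diagonal_matrix :: "real^'d^'d \<Rightarrow> bool" where
  "sign_diagonal_matrix D \<longleftrightarrow>
     (\<forall>a. D $ a $ a = 1 \<or> D $ a $ a = - 1) \<and> (\<forall>a b. a \<noteq> b \<longrightarrow> D $ a $ b = 0)"

definition permutation_matrix :: "real^'d^'d \<Rightarrow> bool" where
  "permutation_matrix P \<longleftrightarrow>
     (\<exists>\<sigma>. \<sigma> permutes UNIV \<and> P = (\<chi> a b. if b = \<sigma> a then 1 else 0))"

definition signed_permutation_matrices :: "(real^'d^'d) set" where
  "signed_permutation_matrices =
     {D ** P | D P. sign_diagonal_matrix D \<and> permutation_matrix P}"

end

theory Submission
  imports Defs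
begin

text \<open>
  Let \<open>t\<^sub>a = T\<^sub>a\<^sub>\<dots>\<^sub>a\<close>, so that the entries of \<open>Q \<bullet> T\<close> are \<open>\<Sum>\<^sub>a t\<^sub>a \<Prod>\<^sub>k Q\<^bsub>i\<^sub>k a\<^esub>\<close>. Contracting
  one slot with the transpose of \<open>Q\<close> undoes the sum over \<open>a\<close>. For \<open>r \<ge> 3\<close>, filling the remaining
  slots with two different values \<open>b\<close>, \<open>c\<close> gives \<open>t\<^sub>a Q\<^sub>b\<^sub>a Q\<^sub>c\<^sub>a\<^bsup>r-2\<^esup> = 0\<close>; thus all columns with
  \<open>t\<^sub>a \<noteq> 0\<close> have at most one nonzero entry, and orthogonality of the rows of \<open>Q\<close> extends this to the
  possible remaining column. For \<open>r = 2\<close> the contraction gives \<open>t\<^sub>a Q\<^sub>b\<^sub>a = (Q \<bullet> T)\<^sub>b\<^sub>b Q\<^sub>b\<^sub>a\<close>, so that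
  distinct \<open>t\<^sub>a\<close> leave at most one nonzero entry in each row.
\<close>

section \<open>Orthogonality relations in coordinates\<close>

lemma orthogonal_matrix_rows:
  fixes Q :: "real^'n^'n"
  assumes "orthogonal_matrix Q"
  shows "(\<Sum>a\<in>UNIV. Q $ b $ a * Q $ c $ a) = (if b = c then 1 else 0)"
proof -
  have "(Q ** transpose Q) $ b $ c = mat 1 $ b $ c"
    using assms by (simp add: orthogonal_matrix_def)
  then show ?thesis
    by (simp add: matrix_matrix_mult_def transpose_def mat_def)
qed

lemma orthogonal_matrix_columns:
  fixes Q :: "real^'n^'n"
  assumes "orthogonal_matrix Q"
  shows "(\<Sum>b\<in>UNIV. Q $ b $ a * Q $ b $ c) = (if a = c then 1 else 0)"
proof -
  have "(transpose Q ** Q) $ a $ c = mat 1 $ a $ c"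
    using assms by (simp add: orthogonal_matrix_def)
  then show ?thesis
    by (simp add: matrix_matrix_mult_def transpose_def mat_def)
qed

text \<open>The double sum is entry \<open>a\<close> of \<open>transpose Q *v (Q *v v)\<close>. This
  form matches the sum obtained by contracting one tensor slot with
  \<open>transpose Q\<close>.\<close>

lemma orthogonal_matrix_invert_sum:
  fixes Q :: "real^'n^'n"
  assumes "orthogonal_matrix Q"
  shows "(\<Sum>m\<in>UNIV. Q $ m $ a * (\<Sum>c\<in>UNIV. Q $ m $ c * v c)) = v a"
proof -
  have "(\<Sum>m\<in>UNIV. Q $ m $ a * (\<Sum>c\<in>UNIV. Q $ m $ c * v c))
      = (\<Sum>m\<in>UNIV. \<Sum>c\<in>UNIV. Q $ m $ a * Q $ m $ c * v c)"
    by (simp add: sum_distrib_left mult.assoc)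
  also have "\<dots> = (\<Sum>c\<in>UNIV. (\<Sum>m\<in>UNIV. Q $ m $ a * Q $ m $ c) * v c)"
    by (subst sum.swap) (simp add: sum_distrib_right)
  also have "\<dots> = (\<Sum>c\<in>UNIV. if a = c then v c else 0)"
    by (intro sum.cong refl) (simp add: orthogonal_matrix_columns[OF assms])
  finally show ?thesis
    by simp
qed

section \<open>Signed permutation matrices\<close>

text \<open>Row \<open>a\<close> of \<open>D ** P\<close> is row \<open>a\<close> of
  \<open>P\<close> scaled by the sign \<open>D $ a $ a\<close>. The entrywise form spares later
  arguments the matrix product.\<close>

lemma signed_permutation_matrices_iff:
  fixes Q :: "real^'n^'n"
  shows "Q \<in> signed_permutation_matrices \<longleftrightarrow>
    (\<exists>\<sigma> \<epsilon>. \<sigma> permutes UNIV \<and> (\<forall>a. \<epsilon> a = 1 \<or> \<epsilon> a = - 1) \<and>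
      (\<forall>a b. Q $ a $ b = (if b = \<sigma> a then \<epsilon> a else 0)))"
proof
  assume "Q \<in> signed_permutation_matrices"
  then obtain D P \<sigma> where Q: "Q = D ** P" and D: "sign_diagonal_matrix D"
    and \<sigma>: "\<sigma> permutes UNIV" and P: "P = (\<chi> a b. if b = \<sigma> a then 1 else 0)"
    by (auto simp: signed_permutation_matrices_def permutation_matrix_def)
  have "Q $ a $ b = (if b = \<sigma> a then D $ a $ a else 0)" for a b
  proof -
    have "Q $ a $ b = (\<Sum>c\<in>UNIV. D $ a $ c * P $ c $ b)"
      by (simp add: Q matrix_matrix_mult_def)
    also have "\<dots> = (\<Sum>c\<in>UNIV. if c = a then D $ a $ a * P $ a $ b else 0)"
      using D by (intro sum.cong) (auto simp: sign_diagonal_matrix_def)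
    finally show ?thesis
      by (simp add: P)
  qed
  then show "\<exists>\<sigma> \<epsilon>. \<sigma> permutes UNIV \<and> (\<forall>a. \<epsilon> a = 1 \<or> \<epsilon> a = - 1) \<and>
      (\<forall>a b. Q $ a $ b = (if b = \<sigma> a then \<epsilon> a else 0))"
    using \<sigma> D by (intro exI[of _ \<sigma>] exI[of _ "\<lambda>a. D $ a $ a"]) (auto simp: sign_diagonal_matrix_def)
next
  assume "\<exists>\<sigma> \<epsilon>. \<sigma> permutes UNIV \<and> (\<forall>a. \<epsilon> a = 1 \<or> \<epsilon> a = - 1) \<and>
      (\<forall>a b. Q $ a $ b = (if b = \<sigma> a then \<epsilon> a else 0))"
  then obtain \<sigma> \<epsilon> where \<sigma>: "\<sigma> permutes UNIV" and \<epsilon>: "\<forall>a. \<epsilon> a = 1 \<or> \<epsilon> a = - 1"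
    and Q: "\<forall>a b. Q $ a $ b = (if b = \<sigma> a then \<epsilon> a else 0)"
    by blast
  define D :: "real^'n^'n" where "D = (\<chi> a b. if a = b then \<epsilon> a else 0)"
  define P :: "real^'n^'n" where "P = (\<chi> a b. if b = \<sigma> a then 1 else 0)"
  have "(D ** P) $ a $ b = Q $ a $ b" for a b
  proof -
    have "(D ** P) $ a $ b = (\<Sum>c\<in>UNIV. if c = a then \<epsilon> a * P $ a $ b else 0)"
      unfolding matrix_matrix_mult_def vec_lambda_beta
      by (rule sum.cong) (auto simp: D_def)
    then show ?thesis
      by (simp add: P_def Q)
  qed
  then have "Q = D ** P"
    by (simp add: vec_eq_iff)
  moreover have "sign_diagonal_matrix D"
    using \<epsilon> by (simp add: D_def sign_diagonal_matrix_def)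
  moreover have "permutation_matrix P"
    using \<sigma> by (auto simp: P_def permutation_matrix_def)
  ultimately show "Q \<in> signed_permutation_matrices"
    by (auto simp: signed_permutation_matrices_def)
qed

lemma signed_permutation_matrix_column:
  fixes Q :: "real^'n^'n"
  assumes "Q \<in> signed_permutation_matrices" "b \<noteq> c"
  shows "Q $ b $ a = 0 \<or> Q $ c $ a = 0"
proof -
  obtain \<sigma> \<epsilon> where \<sigma>: "\<sigma> permutes UNIV"
    and Q: "\<And>a b. Q $ a $ b = (if b = \<sigma> a then \<epsilon> a else 0)"
    using assms(1) unfolding signed_permutation_matrices_iff by blast
  have "\<sigma> b \<noteq> \<sigma> c"
    using assms(2) permutes_inj[OF \<sigma>] by (simp add: inj_eq)
  then show ?thesis
    by (auto simp: Q)
qed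

lemma signed_permutation_matrix_orthogonal:
  fixes Q :: "real^'n^'n"
  assumes "Q \<in> signed_permutation_matrices"
  shows "orthogonal_matrix Q"
proof -
  obtain \<sigma> \<epsilon> where \<epsilon>: "\<And>a. \<epsilon> a = 1 \<or> \<epsilon> a = - 1"
    and Q: "\<And>a b. Q $ a $ b = (if b = \<sigma> a then \<epsilon> a else 0)"
    using assms unfolding signed_permutation_matrices_iff by blast
  have "(Q ** transpose Q) $ b $ c = mat 1 $ b $ c" for b c
  proof (cases "b = c")
    case True
    have "\<epsilon> b * \<epsilon> b = 1"
      using \<epsilon>[of b] by auto
    moreover have "(\<Sum>a\<in>UNIV. Q $ b $ a * Q $ b $ a)
        = (\<Sum>a\<in>UNIV. if a = \<sigma> b then \<epsilon> b * \<epsilon> b else 0)"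
      by (intro sum.cong) (auto simp: Q)
    ultimately show ?thesis
      using True by (simp add: matrix_matrix_mult_def transpose_def mat_def)
  next
    case False
    then have "(\<Sum>a\<in>UNIV. Q $ b $ a * Q $ c $ a) = 0"
      using signed_permutation_matrix_column[OF assms False] by (intro sum.neutral) simp
    then show ?thesis
      using False by (simp add: matrix_matrix_mult_def transpose_def mat_def)
  qed
  then have "Q ** transpose Q = mat 1"
    by (simp add: vec_eq_iff)
  then show ?thesis
    by (simp add: orthogonal_matrix_def matrix_left_right_inverse)
qed

text \<open>Rows have norm one, so each has a nonzero entry, unique by sparsity; its position
  defines \<sigma>. The inner product of rows \<open>b\<close> and \<open>c\<close> is then a single
  product: it would be nonzero if \<sigma> sent distinct \<open>b\<close>, \<open>c\<close> to the
  same column, and for \<open>b = c\<close> it shows that the entry is a sign.\<close>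

lemma orthogonal_matrix_sparse_rows:
  fixes Q :: "real^'n^'n"
  assumes Q: "orthogonal_matrix Q"
    and sparse: "\<And>b a c. a \<noteq> c \<Longrightarrow> Q $ b $ a = 0 \<or> Q $ b $ c = 0"
  shows "Q \<in> signed_permutation_matrices"
proof -
  have "\<exists>a. Q $ b $ a \<noteq> 0" for b
    using orthogonal_matrix_rows[OF Q, of b b] by (auto intro: ccontr)
  then obtain \<sigma> where \<sigma>: "\<And>b. Q $ b $ \<sigma> b \<noteq> 0"
    by metis
  have zero: "Q $ b $ a = 0" if "a \<noteq> \<sigma> b" for a b
    using sparse[OF that, of b] \<sigma>[of b] by simp
  have inner: "Q $ b $ \<sigma> b * Q $ c $ \<sigma> b = (if b = c then 1 else 0)" for b c
  proof -
    have "(\<Sum>a\<in>UNIV. Q $ b $ a * Q $ c $ a)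
        = (\<Sum>a\<in>UNIV. if a = \<sigma> b then Q $ b $ \<sigma> b * Q $ c $ \<sigma> b else 0)"
      by (intro sum.cong) (auto simp: zero)
    then show ?thesis
      by (simp add: orthogonal_matrix_rows[OF Q])
  qed
  have "inj \<sigma>"
  proof (rule injI, rule ccontr)
    fix b c assume "\<sigma> b = \<sigma> c" "b \<noteq> c"
    then show False
      using inner[of b c] \<sigma>[of b] \<sigma>[of c] by simp
  qed
  then have "\<sigma> permutes UNIV"
    by (intro bij_imp_permutes) (auto simp: bij_betw_def finite_UNIV_inj_surj)
  moreover have "Q $ b $ \<sigma> b = 1 \<or> Q $ b $ \<sigma> b = - 1" for b
    using inner[of b b] by (simp add: square_eq_1_iff)
  ultimately show ?thesis
    unfolding signed_permutation_matrices_iff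
    by (intro exI[of _ \<sigma>] exI[of _ "\<lambda>b. Q $ b $ \<sigma> b"]) (auto simp: zero)
qed

text \<open>Reduction to sparse rows: if row \<open>b\<close> had nonzero entries in columns
  \<open>a\<close> and \<open>c\<close>, column sparsity would leave only the term of row
  \<open>b\<close> in the inner product of these columns, contradicting their orthogonality.\<close>

lemma orthogonal_matrix_sparse_columns:
  fixes Q :: "real^'n^'n"
  assumes Q: "orthogonal_matrix Q"
    and sparse: "\<And>a b c. b \<noteq> c \<Longrightarrow> Q $ b $ a = 0 \<or> Q $ c $ a = 0"
  shows "Q \<in> signed_permutation_matrices"
proof (rule orthogonal_matrix_sparse_rows[OF Q], rule ccontr)
  fix b a c assume "a \<noteq> c" and nz: "\<not> (Q $ b $ a = 0 \<or> Q $ b $ c = 0)"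
  have "(\<Sum>m\<in>UNIV. Q $ m $ a * Q $ m $ c)
      = (\<Sum>m\<in>UNIV. if m = b then Q $ b $ a * Q $ b $ c else 0)"
    using nz sparse[of _ b] by (intro sum.cong) auto
  then show False
    using orthogonal_matrix_columns[OF Q, of a c] \<open>a \<noteq> c\<close> nz by simp
qed

section \<open>The action on symmetric and on diagonal tensors\<close>

text \<open>A permutation of the slots of \<open>i\<close> is moved to the summation index by
  reindexing the sum over \<open>j\<close>, and is then absorbed by the symmetry of
  \<open>T\<close>.\<close>

lemma tensor_act_symmetric:
  fixes T :: "('r::finite, 'd::finite) tensor"
  assumes "T \<in> symmetric_tensors"
  shows "A \<bullet>\<^sub>T T \<in> symmetric_tensors"
proof -
  have "(A \<bullet>\<^sub>T T) $ (i \<circ> \<pi>) = (A \<bullet>\<^sub>T T) $ i" if \<pi>: "\<pi> permutes UNIV" for \<pi> i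
  proof -
    have bij: "bij (\<lambda>j :: 'r \<Rightarrow> 'd. j \<circ> \<pi>)"
      by (rule o_bij[of "\<lambda>j. j \<circ> inv \<pi>"])
        (auto simp: fun_eq_iff permutes_inverses[OF \<pi>])
    have "(A \<bullet>\<^sub>T T) $ (i \<circ> \<pi>) = (\<Sum>j\<in>UNIV. (\<Prod>k\<in>UNIV. A $ i (\<pi> k) $ j k) * T $ j)"
      by (simp add: tensor_act_def)
    also have "\<dots> = (\<Sum>j\<in>UNIV. (\<Prod>k\<in>UNIV. A $ i (\<pi> k) $ j (\<pi> k)) * T $ (j \<circ> \<pi>))"
      by (subst sum.reindex_bij_betw[OF bij, symmetric]) simp
    also have "\<dots> = (\<Sum>j\<in>UNIV. (\<Prod>k\<in>UNIV. A $ i k $ j k) * T $ j)"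
    proof (intro sum.cong refl arg_cong2[of _ _ _ _ "(*)"])
      fix j :: "'r \<Rightarrow> 'd"
      show "(\<Prod>k\<in>UNIV. A $ i (\<pi> k) $ j (\<pi> k)) = (\<Prod>k\<in>UNIV. A $ i k $ j k)"
        by (rule prod.reindex_bij_betw[OF permutes_imp_bij[OF \<pi>], of "\<lambda>k. A $ i k $ j k"])
      show "T $ (j \<circ> \<pi>) = T $ j"
        using assms \<pi> by (simp add: symmetric_tensors_def)
    qed
    finally show ?thesis
      by (simp add: tensor_act_def)
  qed
  then show ?thesis
    by (simp add: symmetric_tensors_def)
qed

lemma tensor_act_diagonal:
  fixes T :: "('r::finite, 'd::finite) tensor"
  assumes "diagonal_tensor T"
  shows "(A \<bullet>\<^sub>T T) $ i = (\<Sum>a\<in>UNIV. (\<Prod>k\<in>UNIV. A $ i k $ a) * tensor_diag T a)"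
proof -
  let ?c = "\<lambda>(a::'d) (_::'r). a"
  have "T $ j = 0" if "j \<notin> range ?c" for j
  proof -
    have "\<not> (\<forall>k l. j k = j l)"
    proof
      assume "\<forall>k l. j k = j l"
      then have "j = ?c (j undefined)"
        by auto
      with that show False
        by blast
    qed
    then show ?thesis
      using assms by (simp add: diagonal_tensor_def)
  qed
  then have "(A \<bullet>\<^sub>T T) $ i = (\<Sum>j\<in>range ?c. (\<Prod>k\<in>UNIV. A $ i k $ j k) * T $ j)"
    by (simp add: tensor_act_def) (rule sum.mono_neutral_right; simp)
  also have "\<dots> = (\<Sum>a\<in>UNIV. (\<Prod>k\<in>UNIV. A $ i k $ a) * tensor_diag T a)"
    by (subst sum.reindex) (auto simp: inj_def fun_eq_iff tensor_diag_def)
  finally show ?thesis .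
qed

text \<open>A nonconstant \<open>i\<close> selects two different rows of \<open>Q\<close>, and every
  column vanishes in at least one of them, so each summand is zero.\<close>

lemma tensor_act_signed_permutation:
  fixes T :: "('r::finite, 'd::finite) tensor"
  assumes "diagonal_tensor T" "Q \<in> signed_permutation_matrices"
  shows "diagonal_tensor (Q \<bullet>\<^sub>T T)"
  unfolding diagonal_tensor_def
proof (intro allI impI)
  fix i :: "'r \<Rightarrow> 'd" assume "\<not> (\<forall>k l. i k = i l)"
  then obtain k l where "i k \<noteq> i l"
    by blast
  then have "Q $ i k $ a = 0 \<or> Q $ i l $ a = 0" for a
    using signed_permutation_matrix_column[OF assms(2)] by blast
  then have "(\<Prod>k\<in>UNIV. Q $ i k $ a) = 0" for a
    by (metis (no_types, lifting) UNIV_I finite prod_zero)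
  then show "(Q \<bullet>\<^sub>T T) $ i = 0"
    unfolding tensor_act_diagonal[OF assms(1)] by (intro sum.neutral) (simp del: prod_zero_iff)
qed

lemma tensor_act_contract:
  fixes T :: "('r::finite, 'd::finite) tensor"
  assumes "orthogonal_matrix Q" "diagonal_tensor T"
  shows "(\<Sum>m\<in>UNIV. Q $ m $ a * (Q \<bullet>\<^sub>T T) $ (j(k0 := m)))
       = (\<Prod>k\<in>UNIV - {k0}. Q $ j k $ a) * tensor_diag T a"
proof -
  \<comment> \<open>The factor of slot \<open>k0\<close> is split off; what remains depends only on
    the column \<open>c\<close> and serves as the vector \<open>v\<close> in
    \<open>orthogonal_matrix_invert_sum\<close>.\<close>
  have "(Q \<bullet>\<^sub>T T) $ (j(k0 := m))
      = (\<Sum>c\<in>UNIV. Q $ m $ c * ((\<Prod>k\<in>UNIV - {k0}. Q $ j k $ c) * tensor_diag T c))" for m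
  proof -
    have "(\<Prod>k\<in>UNIV. Q $ (j(k0 := m)) k $ c) = Q $ m $ c * (\<Prod>k\<in>UNIV - {k0}. Q $ j k $ c)" for c
      by (subst prod.remove[of _ k0]) (auto intro!: prod.cong)
    then show ?thesis
      by (simp only: tensor_act_diagonal[OF assms(2)] mult.assoc)
  qed
  then show ?thesis
    by (simp add: orthogonal_matrix_invert_sum[OF assms(1)])
qed

section \<open>Diagonal images force signed permutations\<close>

lemma diagonal_tensor_act_order_ge_3:
  fixes T :: "('r::finite, 'd::finite) tensor"
  assumes r: "CARD('r) \<ge> 3" and nz: "card {a. tensor_diag T a \<noteq> 0} \<ge> CARD('d) - 1"
    and T: "diagonal_tensor T" and Q: "orthogonal_matrix Q" and QT: "diagonal_tensor (Q \<bullet>\<^sub>T T)"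
  shows "Q \<in> signed_permutation_matrices"
proof (rule orthogonal_matrix_sparse_columns[OF Q])
  \<comment> \<open>Slot \<open>k0\<close> is contracted, while \<open>k1\<close> and
    \<open>k2\<close> survive to carry the two different values \<open>b\<close> and
    \<open>c\<close>; hence the need for order at least three.\<close>
  obtain k0 k1 k2 :: 'r where k: "k0 \<noteq> k1" "k0 \<noteq> k2" "k1 \<noteq> k2"
    using r card_le_Suc_iff[of 2 "UNIV :: 'r set"]
    by (auto simp: numeral_3_eq_3 numeral_2_eq_2 card_le_Suc_iff)
  have sparse: "Q $ b $ a = 0 \<or> Q $ c $ a = 0" if "tensor_diag T a \<noteq> 0" "b \<noteq> c" for a b c
  proof -
    define j where "j = (\<lambda>k. if k = k1 then b else c)"
    have "(Q \<bullet>\<^sub>T T) $ (j(k0 := m)) = 0" for m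
    proof -
      have "(j(k0 := m)) k1 \<noteq> (j(k0 := m)) k2"
        using k that(2) by (simp add: j_def)
      then show ?thesis
        using QT unfolding diagonal_tensor_def by blast
    qed
    then have "(\<Prod>k\<in>UNIV - {k0}. Q $ j k $ a) = 0"
      using tensor_act_contract[OF Q T, of a j k0] that(1) by simp
    then obtain k where "Q $ j k $ a = 0"
      by auto
    then show ?thesis
      by (auto simp: j_def split: if_splits)
  qed
  fix a b c :: 'd assume "b \<noteq> c"
  show "Q $ b $ a = 0 \<or> Q $ c $ a = 0"
  proof (cases "tensor_diag T a = 0")
    case True
    \<comment> \<open>So \<open>a\<close> is the only exceptional column. All other columns
      contribute zero to the inner product of rows \<open>b\<close> and \<open>c\<close>, which is
      itself zero.\<close>
    have "card {a. tensor_diag T a = 0} \<le> Suc 0"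
    proof -
      have "{a. tensor_diag T a = 0} = UNIV - {a. tensor_diag T a \<noteq> 0}"
        by auto
      then show ?thesis
        using nz by (simp add: card_Diff_subset)
    qed
    then have "tensor_diag T e \<noteq> 0" if "e \<noteq> a" for e
      using True that by (auto simp: card_le_Suc0_iff_eq)
    then have "Q $ b $ e * Q $ c $ e = 0" if "e \<noteq> a" for e
      using sparse[OF _ \<open>b \<noteq> c\<close>] that by simp
    then have "(\<Sum>e\<in>UNIV. Q $ b $ e * Q $ c $ e)
        = (\<Sum>e\<in>UNIV. if e = a then Q $ b $ a * Q $ c $ a else 0)"
      by (intro sum.cong) auto
    then show ?thesis
      using orthogonal_matrix_rows[OF Q, of b c] \<open>b \<noteq> c\<close> by simp
  qed (use sparse \<open>b \<noteq> c\<close> in blast)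
qed

lemma diagonal_tensor_act_order_2:
  fixes T :: "('r::finite, 'd::finite) tensor"
  assumes r: "CARD('r) = 2" and dist: "\<And>a b. a \<noteq> b \<Longrightarrow> tensor_diag T a \<noteq> tensor_diag T b"
    and T: "diagonal_tensor T" and Q: "orthogonal_matrix Q" and QT: "diagonal_tensor (Q \<bullet>\<^sub>T T)"
  shows "Q \<in> signed_permutation_matrices"
proof (rule orthogonal_matrix_sparse_rows[OF Q])
  obtain k0 k1 :: 'r where k: "UNIV = {k0, k1}" "k0 \<noteq> k1"
    using r by (auto simp: card_2_iff)
  have UNIV_diff: "UNIV - {k0} = {k1}"
    using k by auto
  \<comment> \<open>For order two the action is the congruence \<open>Q ** T ** transpose Q\<close>;
    this compares the entries at \<open>b\<close>, \<open>a\<close> in the identity of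
    \<open>Q\<close> times \<open>T\<close> with the image times \<open>Q\<close>.\<close>
  have eigen: "Q $ b $ a * tensor_diag T a = Q $ b $ a * tensor_diag (Q \<bullet>\<^sub>T T) b" for a b
  proof -
    have "(Q \<bullet>\<^sub>T T) $ ((\<lambda>_. b)(k0 := m)) = (if m = b then tensor_diag (Q \<bullet>\<^sub>T T) b else 0)" for m
    proof (cases "m = b")
      case True
      then show ?thesis
        by (simp add: tensor_diag_def fun_upd_idem)
    next
      case False
      then have "((\<lambda>_. b)(k0 := m)) k0 \<noteq> ((\<lambda>_. b)(k0 := m)) k1"
        using k by simp
      then have "(Q \<bullet>\<^sub>T T) $ ((\<lambda>_. b)(k0 := m)) = 0"
        using QT unfolding diagonal_tensor_def by blast
      with False show ?thesis
        by simp
    qed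
    then have "(\<Sum>m\<in>UNIV. Q $ m $ a * (Q \<bullet>\<^sub>T T) $ ((\<lambda>_. b)(k0 := m)))
        = (\<Sum>m\<in>UNIV. if m = b then Q $ b $ a * tensor_diag (Q \<bullet>\<^sub>T T) b else 0)"
      by (intro sum.cong) (simp only:, simp)
    then have "Q $ b $ a * tensor_diag T a
        = (\<Sum>m\<in>UNIV. if m = b then Q $ b $ a * tensor_diag (Q \<bullet>\<^sub>T T) b else 0)"
      using tensor_act_contract[OF Q T, of a "\<lambda>_. b" k0] by (simp only: UNIV_diff) simp
    then show ?thesis
      by simp
  qed
  \<comment> \<open>Two nonzero entries in row \<open>b\<close> could be cancelled from
    \<open>eigen\<close>, making both diagonal values of \<open>T\<close> equal to
    \<open>tensor_diag (Q \<bullet>\<^sub>T T) b\<close>.\<close>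
  show "Q $ b $ a = 0 \<or> Q $ b $ c = 0" if "a \<noteq> c" for a b c
    using eigen[of b a] eigen[of b c] dist[OF that] by auto
qed

theorem theorem5p3:
  fixes T :: "('r::finite, 'd::finite) tensor"
  assumes "T \<in> V_diag"
    and "(CARD('r) \<ge> 3 \<and> card {a. tensor_diag T a \<noteq> 0} \<ge> CARD('d) - 1) \<or>
         (CARD('r) = 2 \<and> (\<forall>a b. a \<noteq> b \<longrightarrow> tensor_diag T a \<noteq> tensor_diag T b))"
  shows "(\<forall>Q \<in> orthogonal_group. diagonal_tensor (Q \<bullet>\<^sub>T T) \<longleftrightarrow> Q \<in> signed_permutation_matrices) \<and>
         {Q \<in> orthogonal_group. Q \<bullet>\<^sub>T T \<in> V_diag} = signed_permutation_matrices"
proof -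
  have T: "diagonal_tensor T" "T \<in> symmetric_tensors"
    using assms(1) by (auto simp: V_diag_def)
  have "diagonal_tensor (Q \<bullet>\<^sub>T T) \<longleftrightarrow> Q \<in> signed_permutation_matrices"
    if "Q \<in> orthogonal_group" for Q
    using that assms(2) T(1) diagonal_tensor_act_order_ge_3[of T Q]
      diagonal_tensor_act_order_2[of T Q] tensor_act_signed_permutation[of T Q]
    by (auto simp: orthogonal_group_def)
  \<comment> \<open>The set equation also requires the image to be symmetric and signed permutation
    matrices to be orthogonal.\<close>
  then show ?thesis
    using tensor_act_symmetric[OF T(2)] signed_permutation_matrix_orthogonal
    by (auto simp: V_diag_def orthogonal_group_def)
qed

end
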